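(* Let $P$ be a finite poset and let $h=h(P)$. If $P$ is thin, then for all $n\ge h$, \[ M_1(P,n)=\binom{n-h}{\lfloor (n-h)/2\rfloor}. \] If $P$ is slim, then for all $n\ge h$, \[ M_1(P,n)=M_2(P,n)=\binom{n-h}{\lfloor (n-h)/2\rfloor}. \]
   Context: $B_n$ denotes the poset of all subsets of $[n]$ ordered by inclusion. For a finite poset $(P,<_p)$, an embedding $f:P\to B_n$ is an injective map with $f(a)\subset f(b)$ whenever $a<_p b$; an induced embedding is an injective map with $f(a)\subset f(b)$ if and only if $a<_p b$. Two sets $X,Y$ of subsets of $[n]$ are incomparable if there are no $x\in X$, $y\in Y$ with $x\subseteq y$ or $y\subseteq x$; a family of sets of subsets is incomparable if its members are pairwise incomparable. $M_1(P,n)$ (resp. $M_2(P,n)$) is the largest $M$ such that there exist embeddings (resp. induced embeddings) $f_1,\dots,f_M:P\to B_n$ with $\{\mathrm{Im}(f_i)\}_{i=1}^M$ an incomparable family. The height $h(P)$ is the number of elements in a longest chain of $P$ minus $1$. $P$ is thin if it has an embedding into $B_{h(P)}$, and slim if it has an induced embedding into $B_{h(P)}$. *)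

theory Defs
  imports Complex_Main
begin

text \<open>A finite poset is a carrier set \<open>P\<close> with a reflexive order relation \<open>r\<close> such that
  \<^term>\<open>partial_order_on P r\<close>.\<close>

definition strictly_below :: "'a rel \<Rightarrow> 'a \<Rightarrow> 'a \<Rightarrow> bool" where
  "strictly_below r a b \<longleftrightarrow> (a, b) \<in> r \<and> a \<noteq> b"

definition boolean_lattice :: "nat \<Rightarrow> nat set set" where
  "boolean_lattice n = Pow {1..n}"

definition embedding :: "'a set \<Rightarrow> 'a rel \<Rightarrow> nat \<Rightarrow> ('a \<Rightarrow> nat set) \<Rightarrow> bool" where
  "embedding P r n f \<longleftrightarrow> f ` P \<subseteq> boolean_lattice n \<and> inj_on f P \<and>
     (\<forall>a\<in>P. \<forall>b\<in>P. strictly_below r a b \<longrightarrow> f a \<subset> f b)"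

definition induced_embedding :: "'a set \<Rightarrow> 'a rel \<Rightarrow> nat \<Rightarrow> ('a \<Rightarrow> nat set) \<Rightarrow> bool" where
  "induced_embedding P r n f \<longleftrightarrow> f ` P \<subseteq> boolean_lattice n \<and> inj_on f P \<and>
     (\<forall>a\<in>P. \<forall>b\<in>P. f a \<subset> f b \<longleftrightarrow> strictly_below r a b)"

definition incomparable :: "'b set set \<Rightarrow> 'b set set \<Rightarrow> bool" where
  "incomparable X Y \<longleftrightarrow> \<not> (\<exists>x\<in>X. \<exists>y\<in>Y. x \<subseteq> y \<or> y \<subseteq> x)"

text \<open>The family is indexed, so repeated members are compared with each other: for nonempty
  \<open>P\<close>, maps with the same image cannot occur at two different indices.\<close>

definition incomparable_family :: "'i set \<Rightarrow> ('i \<Rightarrow> 'b set set) \<Rightarrow> bool" where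
  "incomparable_family I F \<longleftrightarrow> pairwise (\<lambda>i j. incomparable (F i) (F j)) I"

text \<open>For nonempty \<open>P\<close> the images in an incomparable family are nonempty and pairwise disjoint,
  so the admissible \<open>M\<close> below (which include \<open>0\<close>) are bounded by \<open>2 ^ n\<close>, and \<open>GREATEST\<close> is
  a genuine maximum.\<close>

definition M1 :: "'a set \<Rightarrow> 'a rel \<Rightarrow> nat \<Rightarrow> nat" where
  "M1 P r n = (GREATEST M. \<exists>f :: nat \<Rightarrow> 'a \<Rightarrow> nat set.
     (\<forall>i\<in>{1..M}. embedding P r n (f i)) \<and> incomparable_family {1..M} (\<lambda>i. f i ` P))"

definition M2 :: "'a set \<Rightarrow> 'a rel \<Rightarrow> nat \<Rightarrow> nat" where
  "M2 P r n = (GREATEST M. \<exists>f :: nat \<Rightarrow> 'a \<Rightarrow> nat set.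
     (\<forall>i\<in>{1..M}. induced_embedding P r n (f i)) \<and> incomparable_family {1..M} (\<lambda>i. f i ` P))"

text \<open>For finite nonempty \<open>P\<close> every singleton is a chain, so the natural-number subtraction
  does not truncate.\<close>

definition height :: "'a set \<Rightarrow> 'a rel \<Rightarrow> nat" where
  "height P r = Max {card C | C. C \<subseteq> P \<and> C \<in> Chains r} - 1"

definition thin :: "'a set \<Rightarrow> 'a rel \<Rightarrow> bool" where
  "thin P r \<longleftrightarrow> (\<exists>f. embedding P r (height P r) f)"

definition slim :: "'a set \<Rightarrow> 'a rel \<Rightarrow> bool" where
  "slim P r \<longleftrightarrow> (\<exists>f. induced_embedding P r (height P r) f)"

end

(* Upper bound: a longest chain of P is sent by the i-th embedding to a chain of sets with bottom A_i
   and top B_i, where B_i - A_i has at least h elements and A_i is not contained in B_j for i \<noteq> j.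
   Thus A_i and the complement of B_i form a cross-intersecting set-pair system, and Bollobas'
   inequality bounds the number of pairs by the central binomial coefficient of n - h.
   Lower bound: take the union of an embedding into the first h points with each set in the middle
   layer of the remaining n - h points. *)
theory Submission
  imports Defs
begin

section \<open>Bollobas' set-pair inequality and its consequence for intervals\<close>

text \<open>Balances the averaging below: removing in turn each of the \<open>b\<close> points of a
  second set gives \<open>b\<close> weights for the sizes \<open>a\<close> and \<open>b - 1\<close>.
  Positivity of \<open>b\<close> keeps \<open>b - 1\<close> from truncating.\<close>

lemma weight_absorb:
  fixes a b :: nat
  assumes "b > 0"
  shows "real b / real ((a + (b - 1)) choose a) = real (a + b) / real ((a + b) choose a)"
proof -
  have "b * ((a + b) choose a) = (a + b) * ((a + (b - 1)) choose a)"
    using binomial_absorb_comp[of "a + b" a] assms by simp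
  then have "real b * real ((a + b) choose a) = real (a + b) * real ((a + (b - 1)) choose a)"
    by (metis of_nat_mult)
  moreover have "real ((a + b) choose a) \<noteq> 0" "real ((a + (b - 1)) choose a) \<noteq> 0"
    by simp_all
  ultimately show ?thesis
    by (simp add: frac_eq_eq)
qed

text \<open>Each weight is the probability that a random ordering of \<open>X\<close> puts all of
  \<open>A i\<close> before all of \<open>B i\<close>, and cross-intersection makes these events
  mutually exclusive. The induction conditions on the last point of the ordering, so only the second
  sets shrink and \<open>A\<close> stays fixed.\<close>

theorem bollobas_set_pairs:
  fixes A B :: "'i \<Rightarrow> 'b set"
  assumes "finite X" "finite I"
    and "\<And>i. i \<in> I \<Longrightarrow> A i \<subseteq> X" "\<And>i. i \<in> I \<Longrightarrow> B i \<subseteq> X"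
    and "\<And>i. i \<in> I \<Longrightarrow> A i \<inter> B i = {}"
    and "\<And>i j. i \<in> I \<Longrightarrow> j \<in> I \<Longrightarrow> i \<noteq> j \<Longrightarrow> A i \<inter> B j \<noteq> {}"
  shows "(\<Sum>i\<in>I. 1 / real ((card (A i) + card (B i)) choose card (A i))) \<le> 1"
  using assms
proof (induction "card X" arbitrary: X I B rule: less_induct)
  case less
  let ?w = "\<lambda>a b. 1 / real ((a + b) choose a)"
  show ?case
  proof (cases "\<exists>i\<in>I. B i = {}")
    case True
    then obtain i where i: "i \<in> I" "B i = {}" by blast
    \<comment> \<open>Any other first set would have to meet the empty \<open>B i\<close>; the
      single remaining weight is 1.\<close>
    with less.prems(6) have "I = {i}" by blast
    with i show ?thesis by simp
  next
    case nonempty: False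
    show ?thesis
    proof (cases "I = {}")
      case True
      then show ?thesis by simp
    next
      case False
      with nonempty less.prems(4) have "X \<noteq> {}" by blast
      then have cX: "card X > 0" using less.prems(1) by (simp add: card_gt_0_iff)
      \<comment> \<open>Average the inequality over all ways of deleting one point \<open>x\<close> from the second sets,
        keeping only the pairs whose first set avoids \<open>x\<close>.\<close>
      have del: "(\<Sum>i\<in>{i\<in>I. x \<notin> A i}. ?w (card (A i)) (card (B i - {x}))) \<le> 1" if x: "x \<in> X" for x
      proof (rule less.hyps[of "X - {x}" "{i\<in>I. x \<notin> A i}" "\<lambda>i. B i - {x}"])
        show "card (X - {x}) < card X" using x less.prems(1) by (rule_tac card_Diff1_less)
        \<comment> \<open>A common point of \<open>A i\<close> and \<open>B j\<close> survives the
          deletion because \<open>x\<close> is not in \<open>A i\<close>.\<close>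
        show "A i \<inter> (B j - {x}) \<noteq> {}" if "i \<in> {i\<in>I. x \<notin> A i}" "j \<in> {i\<in>I. x \<notin> A i}" "i \<noteq> j" for i j
          using less.prems(6)[of i j] that by blast
        show "A i \<inter> (B i - {x}) = {}" if "i \<in> {i\<in>I. x \<notin> A i}" for i
          using less.prems(5)[of i] that by blast
      qed (use less.prems(1-4) in auto)
      \<comment> \<open>Points of \<open>B i\<close> contribute
        \<open>card (A i) + card (B i)\<close> copies of the old weight in total, by absorption;
        each point outside both sets leaves \<open>B i\<close> unchanged and contributes one copy.
        Together this makes \<open>card X\<close> copies.\<close>
      have contrib: "(\<Sum>x\<in>{x\<in>X. x \<notin> A i}. ?w (card (A i)) (card (B i - {x})))
          = real (card X) * ?w (card (A i)) (card (B i))" if i: "i \<in> I" for i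
      proof -
        let ?a = "card (A i)" and ?b = "card (B i)"
        have sub: "A i \<subseteq> X" "B i \<subseteq> X" "A i \<inter> B i = {}" using less.prems i by blast+
        then have fin: "finite (A i)" "finite (B i)" using less.prems(1) finite_subset by blast+
        have "?b > 0" using nonempty i fin by (auto simp: card_gt_0_iff)
        have split: "{x\<in>X. x \<notin> A i} = B i \<union> (X - (A i \<union> B i))" using sub by blast
        have "(\<Sum>x\<in>{x\<in>X. x \<notin> A i}. ?w ?a (card (B i - {x})))
            = (\<Sum>x\<in>B i. ?w ?a (card (B i - {x}))) + (\<Sum>x\<in>X - (A i \<union> B i). ?w ?a (card (B i - {x})))"
          unfolding split by (rule sum.union_disjoint) (use fin less.prems(1) in auto)
        also have "(\<Sum>x\<in>B i. ?w ?a (card (B i - {x}))) = real ?b * ?w ?a (?b - 1)"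
          by simp
        also have "(\<Sum>x\<in>X - (A i \<union> B i). ?w ?a (card (B i - {x}))) = (\<Sum>x\<in>X - (A i \<union> B i). ?w ?a ?b)"
          by (rule sum.cong) auto
        also have "\<dots> = (real (card X) - real (?a + ?b)) * ?w ?a ?b"
        proof -
          have "card (A i \<union> B i) = ?a + ?b" using fin sub(3) by (rule card_Un_disjoint)
          moreover have "card (A i \<union> B i) \<le> card X" using sub less.prems(1) by (intro card_mono) auto
          moreover have "card (X - (A i \<union> B i)) = card X - card (A i \<union> B i)"
            using fin sub by (intro card_Diff_subset) auto
          ultimately show ?thesis by (simp add: of_nat_diff)
        qed
        also have "real ?b * ?w ?a (?b - 1) = real (?a + ?b) * ?w ?a ?b"
          using weight_absorb[OF \<open>?b > 0\<close>, of ?a] by simp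
        finally show ?thesis by (simp only: left_diff_distrib)
      qed
      have "real (card X) * (\<Sum>i\<in>I. ?w (card (A i)) (card (B i)))
          = (\<Sum>i\<in>I. \<Sum>x\<in>{x\<in>X. x \<notin> A i}. ?w (card (A i)) (card (B i - {x})))"
        unfolding sum_distrib_left by (rule sum.cong) (simp_all only: contrib)
      also have "\<dots> = (\<Sum>x\<in>X. \<Sum>i\<in>{i\<in>I. x \<notin> A i}. ?w (card (A i)) (card (B i - {x})))"
        by (rule sum.swap_restrict) (use less.prems in auto)
      also have "\<dots> \<le> (\<Sum>x\<in>X. 1)" by (rule sum_mono) (rule del)
      finally have "real (card X) * (\<Sum>i\<in>I. ?w (card (A i)) (card (B i))) \<le> real (card X) * 1" by simp
      then show ?thesis using cX by (simp only: mult_le_cancel_left_pos of_nat_0_less_iff)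
    qed
  qed
qed

text \<open>For the pairs \<open>A i\<close> and \<open>X - B i\<close>, the non-inclusions
  \<open>cross\<close> are exactly the required intersections. The two sizes add up to
  \<open>card X - card (B i - A i)\<close>, so the gap makes every Bollobas weight at least the
  reciprocal of the central binomial coefficient.\<close>

lemma card_intervals_le:
  fixes A B :: "'i \<Rightarrow> 'b set"
  assumes "finite X" "finite I"
    and sub: "\<And>i. i \<in> I \<Longrightarrow> A i \<subseteq> B i" "\<And>i. i \<in> I \<Longrightarrow> B i \<subseteq> X"
    and gap: "\<And>i. i \<in> I \<Longrightarrow> h \<le> card (B i - A i)"
    and cross: "\<And>i j. i \<in> I \<Longrightarrow> j \<in> I \<Longrightarrow> i \<noteq> j \<Longrightarrow> \<not> A i \<subseteq> B j"
  shows "card I \<le> (card X - h) choose ((card X - h) div 2)"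
proof -
  let ?N = "(card X - h) choose ((card X - h) div 2)"
  let ?k = "\<lambda>i. (card (A i) + card (X - B i)) choose card (A i)"
  have le: "?k i \<le> ?N" if i: "i \<in> I" for i
  proof -
    have fin: "finite (A i)" "finite (B i)"
      using sub[OF i] \<open>finite X\<close> by (meson finite_subset)+
    have "card (X - B i) = card X - card (B i)" "card (B i - A i) = card (B i) - card (A i)"
      "card (A i) \<le> card (B i)" "card (B i) \<le> card X"
      using sub[OF i] fin \<open>finite X\<close> by (simp_all add: card_Diff_subset card_mono)
    then have "card (A i) + card (X - B i) \<le> card X - h" using gap[OF i] by linarith
    then have "?k i \<le> (card X - h) choose card (A i)" by (rule binomial_right_mono)
    also have "\<dots> \<le> ?N" by (rule binomial_maximum)
    finally show ?thesis .
  qed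
  have "(\<Sum>i\<in>I. 1 / real ?N) \<le> (\<Sum>i\<in>I. 1 / real (?k i))"
  proof (rule sum_mono)
    fix i assume "i \<in> I"
    then have "real (?k i) \<le> real ?N" using le of_nat_le_iff by blast
    moreover have "0 < real (?k i)" by simp
    ultimately show "1 / real ?N \<le> 1 / real (?k i)" by (intro frac_le) simp_all
  qed
  also have "\<dots> \<le> 1"
  proof (rule bollobas_set_pairs[OF \<open>finite X\<close> \<open>finite I\<close>])
    show "A i \<inter> (X - B j) \<noteq> {}" if "i \<in> I" "j \<in> I" "i \<noteq> j" for i j
      using cross[OF that] sub that by blast
  qed (use sub in blast)+
  finally have "real (card I) / real ?N \<le> 1" by simp
  moreover have "?N > 0" by simp
  ultimately have "real (card I) \<le> real ?N" by (simp add: divide_le_eq)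
  then show ?thesis by simp
qed

section \<open>Intervals spanned by the image of a longest chain\<close>

text \<open>Cardinality is injective on a chain of finite sets, so the members have distinct sizes
  between those of the smallest and the largest one.\<close>

lemma chain_of_sets_extremes:
  fixes K :: "'b set set"
  assumes "finite K" "K \<noteq> {}" "\<And>x. x \<in> K \<Longrightarrow> finite x"
    and chain: "\<And>x y. x \<in> K \<Longrightarrow> y \<in> K \<Longrightarrow> x \<subseteq> y \<or> y \<subseteq> x"
  obtains A B where "A \<in> K" "B \<in> K" "A \<subseteq> B" "card K - 1 \<le> card (B - A)"
proof -
  obtain A where A: "A \<in> K" "card A = Min (card ` K)"
    using Min_in[of "card ` K"] assms(1,2) by fastforce
  obtain B where B: "B \<in> K" "card B = Max (card ` K)"
    using Max_in[of "card ` K"] assms(1,2) by fastforce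
  have bounds: "card A \<le> card x \<and> card x \<le> card B" if "x \<in> K" for x
    using that A B assms(1) by simp
  \<comment> \<open>If instead \<open>B \<subseteq> A\<close>, minimality of \<open>card A\<close>
    forces equality.\<close>
  have "A \<subseteq> B"
    using chain[OF A(1) B(1)] bounds[OF A(1)] assms(3)[OF A(1)] card_seteq by blast
  have "inj_on card K"
    by (rule inj_onI) (metis assms(3) chain card_subset_eq)
  then have "card K = card (card ` K)" by (simp add: card_image)
  also have "\<dots> \<le> card {card A..card B}" using bounds by (intro card_mono) auto
  finally have "card K - 1 \<le> card B - card A" by simp
  also have "\<dots> = card (B - A)"
    using \<open>A \<subseteq> B\<close> assms(3)[OF A(1)] by (simp add: card_Diff_subset)
  finally show thesis using that A(1) B(1) \<open>A \<subseteq> B\<close> by blast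
qed

lemma height_chain:
  assumes "finite P" "P \<noteq> {}" "partial_order_on P r"
  obtains C where "C \<subseteq> P" "C \<in> Chains r" "card C = Suc (height P r)"
proof -
  let ?S = "{card C | C. C \<subseteq> P \<and> C \<in> Chains r}"
  have "?S \<subseteq> card ` Pow P" by blast
  then have fin: "finite ?S" using assms(1) by (meson finite_Pow_iff finite_imageI finite_subset)
  \<comment> \<open>A singleton chain shows that the maximum is at least 1, so the
    \<open>- 1\<close> in \<open>height\<close> does not truncate.\<close>
  obtain p where "p \<in> P" using assms(2) by blast
  then have "(p, p) \<in> r" using assms(3) by (auto simp: partial_order_on_def preorder_on_def refl_on_def)
  then have "{p} \<in> Chains r" by (simp add: Chains_def)
  with \<open>p \<in> P\<close> have "card {p} \<in> ?S" by blast
  then have "1 \<in> ?S" by simp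
  then have "1 \<le> Max ?S" using Max_ge[OF fin] by simp
  moreover have "Max ?S \<in> ?S" using \<open>1 \<in> ?S\<close> by (intro Max_in fin) blast
  then obtain C where "C \<subseteq> P" "C \<in> Chains r" "card C = Max ?S" by (smt (verit) mem_Collect_eq)
  ultimately show thesis using that unfolding height_def by simp
qed

text \<open>Order preservation and injectivity turn a longest chain into a chain of
  \<open>Suc (height P r)\<close> sets, whose bottom and top are \<open>A\<close> and
  \<open>B\<close>.\<close>

lemma embedding_interval:
  assumes "finite P" "P \<noteq> {}" "partial_order_on P r" "embedding P r n f"
  obtains A B where "A \<in> f ` P" "B \<in> f ` P" "A \<subseteq> B" "height P r \<le> card (B - A)"
proof -
  obtain C where C: "C \<subseteq> P" "C \<in> Chains r" "card C = Suc (height P r)"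
    using height_chain assms(1-3) by blast
  have "f ` C \<subseteq> f ` P" using C by blast
  have mono: "f a \<subseteq> f b \<or> f b \<subseteq> f a" if "a \<in> C" "b \<in> C" for a b
  proof -
    have "a \<in> P" "b \<in> P" using that C(1) by blast+
    then have "strictly_below r a b \<Longrightarrow> f a \<subset> f b" "strictly_below r b a \<Longrightarrow> f b \<subset> f a"
      using assms(4) unfolding embedding_def by simp_all
    moreover have "(a, b) \<in> r \<or> (b, a) \<in> r" using that C(2) by (simp add: Chains_def)
    ultimately show ?thesis unfolding strictly_below_def by (cases "a = b") auto
  qed
  have "finite x" if "x \<in> f ` C" for x
    using that C assms(4) by (auto simp: embedding_def boolean_lattice_def intro: finite_subset)
  moreover have "finite (f ` C)" "f ` C \<noteq> {}"
    using C assms(1) by (auto intro: finite_subset)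
  moreover have "x \<subseteq> y \<or> y \<subseteq> x" if "x \<in> f ` C" "y \<in> f ` C" for x y
    using that mono by blast
  ultimately obtain A B where "A \<in> f ` C" "B \<in> f ` C" "A \<subseteq> B" "card (f ` C) - 1 \<le> card (B - A)"
    using chain_of_sets_extremes by metis
  moreover have "card (f ` C) = card C"
    using C assms(4) by (intro card_image) (auto simp: embedding_def intro: inj_on_subset)
  ultimately show thesis using that[of A B] C(3) \<open>f ` C \<subseteq> f ` P\<close> by (simp add: subset_iff)
qed

lemma card_incomparable_embeddings_le:
  assumes "finite P" "P \<noteq> {}" "partial_order_on P r"
    and emb: "\<forall>i\<in>{1..M}. embedding P r n (f i)"
    and inc: "incomparable_family {1..M} (\<lambda>i. f i ` P)"
  shows "M \<le> (n - height P r) choose ((n - height P r) div 2)"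
proof -
  have "\<forall>i\<in>{1..M}. \<exists>A B. A \<in> f i ` P \<and> B \<in> f i ` P \<and> A \<subseteq> B \<and> height P r \<le> card (B - A)"
    using embedding_interval[OF assms(1-3)] emb by metis
  then obtain A B where AB: "\<And>i. i \<in> {1..M} \<Longrightarrow> A i \<in> f i ` P"
    "\<And>i. i \<in> {1..M} \<Longrightarrow> B i \<in> f i ` P" "\<And>i. i \<in> {1..M} \<Longrightarrow> A i \<subseteq> B i"
    "\<And>i. i \<in> {1..M} \<Longrightarrow> height P r \<le> card (B i - A i)"
    by metis
  have "card {1..M} \<le> (card {1..n} - height P r) choose ((card {1..n} - height P r) div 2)"
  proof (rule card_intervals_le[where A = A and B = B])
    show "B i \<subseteq> {1..n}" if "i \<in> {1..M}" for i
      using AB(2)[OF that] emb that by (fastforce simp: embedding_def boolean_lattice_def)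
    \<comment> \<open>\<open>A i\<close> and \<open>B j\<close> belong to images with different
      indices, which are incomparable.\<close>
    show "\<not> A i \<subseteq> B j" if "i \<in> {1..M}" "j \<in> {1..M}" "i \<noteq> j" for i j
      using AB(1)[OF that(1)] AB(2)[OF that(2)] inc that
      unfolding incomparable_family_def pairwise_def incomparable_def by blast
  qed (use AB in auto)
  then show ?thesis by simp
qed

section \<open>Shifted copies of an embedding\<close>

lemma psubset_union_disjoint:
  assumes "A \<subseteq> X" "B \<subseteq> X" "S \<inter> X = {}"
  shows "A \<union> S \<subset> B \<union> S \<longleftrightarrow> A \<subset> B"
  using assms by blast

lemma inj_on_union_disjoint:
  assumes "inj_on f P" "f ` P \<subseteq> Pow X" "S \<inter> X = {}"
  shows "inj_on (\<lambda>p. f p \<union> S) P"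
proof (rule inj_onI)
  fix a b assume ab: "a \<in> P" "b \<in> P" "f a \<union> S = f b \<union> S"
  have "f a \<subseteq> X" "f b \<subseteq> X" using ab assms(2) by blast+
  with ab assms(3) have "f a = f b" by blast
  with ab assms(1) show "a = b" by (meson inj_onD)
qed

text \<open>The set \<open>S\<close> lives on points beyond \<open>h\<close>, disjoint from every
  image under \<open>f\<close>, so adding it to all images neither creates nor destroys inclusions
  or equalities.\<close>

lemma embedding_shift:
  assumes "embedding P r h f" "h \<le> n" "S \<subseteq> {h+1..n}"
  shows "embedding P r n (\<lambda>p. f p \<union> S)"
proof -
  have S: "S \<inter> {1..h} = {}" using assms(3) by auto
  have f: "f ` P \<subseteq> Pow {1..h}" "inj_on f P"
    using assms(1) by (auto simp: embedding_def boolean_lattice_def)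
  have "f p \<union> S \<subseteq> {1..n}" if "p \<in> P" for p
  proof -
    have "f p \<subseteq> {1..h}" using f that by blast
    then show ?thesis using assms(2,3) by fastforce
  qed
  then have "(\<lambda>p. f p \<union> S) ` P \<subseteq> boolean_lattice n" by (auto simp: boolean_lattice_def)
  moreover have "f a \<union> S \<subset> f b \<union> S \<longleftrightarrow> f a \<subset> f b" if "a \<in> P" "b \<in> P" for a b
    using f(1) S that by (intro psubset_union_disjoint) auto
  ultimately show ?thesis
    using assms(1) inj_on_union_disjoint[OF f(2,1) S] unfolding embedding_def by simp
qed

lemma induced_embedding_imp_embedding:
  "induced_embedding P r n f \<Longrightarrow> embedding P r n f"
  by (simp add: embedding_def induced_embedding_def)

lemma induced_embedding_shift:
  assumes "induced_embedding P r h f" "h \<le> n" "S \<subseteq> {h+1..n}"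
  shows "induced_embedding P r n (\<lambda>p. f p \<union> S)"
proof -
  have emb: "embedding P r h f"
    using assms(1) by (rule induced_embedding_imp_embedding)
  have "f a \<union> S \<subset> f b \<union> S \<longleftrightarrow> f a \<subset> f b" if "a \<in> P" "b \<in> P" for a b
    using emb assms(3) that
    by (intro psubset_union_disjoint[of _ "{1..h}"]) (auto simp: embedding_def boolean_lattice_def)
  then show ?thesis
    using embedding_shift[OF emb assms(2,3)] assms(1)
    unfolding embedding_def induced_embedding_def by simp
qed

text \<open>An inclusion between members of two shifted copies, restricted to the points beyond
  \<open>h\<close>, would be an inclusion between two distinct sets of the same size.\<close>

lemma middle_layer_incomparable:
  fixes h n :: nat and f :: "'a \<Rightarrow> nat set"
  assumes "f ` P \<subseteq> boolean_lattice h"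
  defines "M \<equiv> (n - h) choose ((n - h) div 2)"
  obtains S where "\<And>i. i \<in> {1..M} \<Longrightarrow> S i \<subseteq> {h+1..n}"
    and "incomparable_family {1..M} (\<lambda>i. (\<lambda>p. f p \<union> S i) ` P)"
proof -
  let ?L = "{S. S \<subseteq> {h+1..n} \<and> card S = (n - h) div 2}"
  have "finite ?L" by simp
  moreover have "card ?L = M" unfolding M_def by (subst n_subsets) simp_all
  \<comment> \<open>\<open>S\<close> enumerates the middle layer, so distinct indices give distinct
    sets.\<close>
  ultimately obtain S where S: "bij_betw S {1..M} ?L"
    using ex_bij_betw_nat_finite_1 by blast
  have in_L: "S i \<subseteq> {h+1..n}" "card (S i) = (n - h) div 2" if "i \<in> {1..M}" for i
    using bij_betwE[OF S] that by blast+
  have no_sub: "\<not> f p \<union> S i \<subseteq> f q \<union> S j"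
    if "i \<in> {1..M}" "j \<in> {1..M}" "i \<noteq> j" "p \<in> P" "q \<in> P" for i j p q
  proof
    assume sub: "f p \<union> S i \<subseteq> f q \<union> S j"
    have "f q \<subseteq> {1..h}" using assms(1) that by (auto simp: boolean_lattice_def)
    then have "S i \<inter> f q = {}" using in_L(1)[OF that(1)] by fastforce
    with sub have "S i \<subseteq> S j" by blast
    moreover have "finite (S j)" using in_L(1)[OF that(2)] finite_subset by blast
    ultimately have "S i = S j" using in_L(2) that card_subset_eq by metis
    then show False using inj_onD[OF bij_betw_imp_inj_on[OF S]] that(1-3) by blast
  qed
  have "incomparable_family {1..M} (\<lambda>i. (\<lambda>p. f p \<union> S i) ` P)"
    unfolding incomparable_family_def pairwise_def incomparable_def using no_sub by fastforce
  with in_L(1) that show thesis by blast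
qed

section \<open>The exact values of \<open>M1\<close> and \<open>M2\<close>\<close>

lemma M1_thin:
  assumes "finite P" "P \<noteq> {}" "partial_order_on P r" "thin P r" "height P r \<le> n"
  shows "M1 P r n = (n - height P r) choose ((n - height P r) div 2)" (is "_ = ?N")
proof -
  obtain f where f: "embedding P r (height P r) f" using assms(4) unfolding thin_def by blast
  then have "f ` P \<subseteq> boolean_lattice (height P r)" by (simp add: embedding_def)
  then obtain S where S: "\<And>i. i \<in> {1..?N} \<Longrightarrow> S i \<subseteq> {height P r + 1..n}"
    "incomparable_family {1..?N} (\<lambda>i. (\<lambda>p. f p \<union> S i) ` P)"
    using middle_layer_incomparable[of f P "height P r" n] by metis
  show ?thesis
    unfolding M1_def
  proof (rule Greatest_equality)
    \<comment> \<open>The value is attained by the copies \<open>f p \<union> S i\<close>, one for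
      each set of the middle layer; the other obligation of \<open>Greatest_equality\<close> is the
      upper bound.\<close>
    show "\<exists>g. (\<forall>i\<in>{1..?N}. embedding P r n (g i)) \<and> incomparable_family {1..?N} (\<lambda>i. g i ` P)"
      using S(2) embedding_shift[OF f assms(5) S(1)] by (intro exI[of _ "\<lambda>i p. f p \<union> S i"] conjI ballI)
  qed (elim exE conjE, rule card_incomparable_embeddings_le[OF assms(1-3)])
qed

lemma M2_slim:
  assumes "finite P" "P \<noteq> {}" "partial_order_on P r" "slim P r" "height P r \<le> n"
  shows "M2 P r n = (n - height P r) choose ((n - height P r) div 2)" (is "_ = ?N")
proof -
  obtain f where f: "induced_embedding P r (height P r) f" using assms(4) unfolding slim_def by blast
  then have "f ` P \<subseteq> boolean_lattice (height P r)" by (simp add: induced_embedding_def)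
  then obtain S where S: "\<And>i. i \<in> {1..?N} \<Longrightarrow> S i \<subseteq> {height P r + 1..n}"
    "incomparable_family {1..?N} (\<lambda>i. (\<lambda>p. f p \<union> S i) ` P)"
    using middle_layer_incomparable[of f P "height P r" n] by metis
  show ?thesis
    unfolding M2_def
  proof (rule Greatest_equality)
    show "\<exists>g. (\<forall>i\<in>{1..?N}. induced_embedding P r n (g i)) \<and> incomparable_family {1..?N} (\<lambda>i. g i ` P)"
      using S(2) induced_embedding_shift[OF f assms(5) S(1)] by (intro exI[of _ "\<lambda>i p. f p \<union> S i"] conjI ballI)
  \<comment> \<open>Induced embeddings are embeddings, so they inherit the upper bound.\<close>
  qed (elim exE conjE, rule card_incomparable_embeddings_le[OF assms(1-3)],
    simp_all add: induced_embedding_imp_embedding)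
qed

theorem theorem6:
  fixes P :: "'a set" and r :: "'a rel" and h :: nat
  assumes "finite P" and "P \<noteq> {}" and "partial_order_on P r"
    and "h = height P r"
  shows "(thin P r \<longrightarrow> (\<forall>n\<ge>h. M1 P r n = (n - h) choose ((n - h) div 2))) \<and>
         (slim P r \<longrightarrow> (\<forall>n\<ge>h. M1 P r n = M2 P r n \<and>
            M2 P r n = (n - h) choose ((n - h) div 2)))"
proof -
  \<comment> \<open>This brings the value of \<open>M1\<close> to the slim case as well.\<close>
  have "thin P r" if "slim P r"
    using that induced_embedding_imp_embedding unfolding thin_def slim_def by blast
  then show ?thesis
    using M1_thin[OF assms(1-3)] M2_slim[OF assms(1-3)] assms(4) by simp
qed

end
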